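(* Suppose that $S$ is a nonempty admissible pinnacle set with $\max S=n$. Then $$p_S(n)=\sum_{\emptyset\neq A\subsetneq[n-1]} p_{\mathrm{std}_A(S)}(|A|)\cdot p_{\mathrm{std}_{A^c}(S)}(n-1-|A|),$$ where the sum is over all nonempty proper subsets $A$ of $[n-1]$ and $A^c=[n-1]\setminus A$.
   Context: Let $[n]=\{1,2,\ldots,n\}$ and let $S_n$ be the set of permutations of $[n]$, written as words $w=w(1)w(2)\cdots w(n)$. A pinnacle of $w\in S_n$ is a value $w(i)$ with $2\le i\le n-1$ and $w(i-1)<w(i)>w(i+1)$. The pinnacle set $\mathrm{Pin}(w)$ is the set of all pinnacles of $w$. A set $S$ is an admissible pinnacle set if $S=\mathrm{Pin}(w)$ for some $w\in S_k$ and some $k\ge1$. For a set $S$, $p_S(n)=|\{w\in S_n:\mathrm{Pin}(w)=S\}|$ (so $p_S(n)=0$ if no such $w$ exists). For a finite set of integers $X=\{x_1<x_2<\cdots<x_r\}$, the standardization of $S$ relative to $X$ is $\mathrm{std}_X(S)=\{i\in[r]: x_i\in S\}$. *)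

theory Defs
  imports "HOL-Combinatorics.Permutations"
begin

(* A permutation in S_n is a function w :: nat => nat with "w permutes {1..n}"; such a w is the
   identity outside {1..n}, so these functions correspond bijectively to words w(1)...w(n).
   The length n is not determined by w and hence is an explicit argument of Pin. *)

definition Pin :: "nat \<Rightarrow> (nat \<Rightarrow> nat) \<Rightarrow> nat set" where
  "Pin n w = {w i | i. 2 \<le> i \<and> i \<le> n - 1 \<and> w (i - 1) < w i \<and> w i > w (i + 1)}"

definition admissible_pinnacle_set :: "nat set \<Rightarrow> bool" where
  "admissible_pinnacle_set S \<longleftrightarrow> (\<exists>k\<ge>1. \<exists>w. w permutes {1..k} \<and> S = Pin k w)"

definition pinnacle_count :: "nat set \<Rightarrow> nat \<Rightarrow> nat" where
  "pinnacle_count S n = card {w. w permutes {1..n} \<and> Pin n w = S}"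

(* For a finite set X = {x_1 < ... < x_r}, the element x_i is entry i - 1 of the (0-indexed)
   list sorted_list_of_set X. *)
definition std :: "'a::linorder set \<Rightarrow> 'a set \<Rightarrow> nat set" where
  "std X S = {i \<in> {1..card X}. sorted_list_of_set X ! (i - 1) \<in> S}"

end

theory Submission
  imports Defs "HOL-Combinatorics.Multiset_Permutations"
begin

text \<open>In a word on \<open>[n]\<close> whose pinnacle set contains the maximal letter \<open>n\<close>, this letter is neither
  first nor last, so the word factors as \<open>u n v\<close> with \<open>u\<close> and \<open>v\<close> nonempty. Both neighbours of \<open>n\<close>
  are smaller than \<open>n\<close>, so they are not pinnacles of the word, just as they are not pinnacles of
  \<open>u\<close> and \<open>v\<close>, where they are end letters. Hence the pinnacles are \<open>n\<close> and those of \<open>u\<close> and \<open>v\<close>.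
  Summing over the set \<open>A\<close> of letters of \<open>u\<close> gives the recurrence, since standardization preserves
  the positions of pinnacles.\<close>

section \<open>Pinnacles of words with letters in an arbitrary linear order\<close>

fun pinnacles :: "'a::linorder list \<Rightarrow> 'a set" where
  "pinnacles (a # b # c # xs) = (if a < b \<and> c < b then {b} else {}) \<union> pinnacles (b # c # xs)"
| "pinnacles _ = {}"

lemma pinnacles_subset: "pinnacles xs \<subseteq> set xs"
  by (induction xs rule: pinnacles.induct) auto

text \<open>The letter \<open>m\<close> stands at an end, and the letter after it has a larger left
  neighbour, so neither can be a pinnacle.\<close>

lemma pinnacles_Cons_max:
  assumes "\<And>x. x \<in> set xs \<Longrightarrow> x < m"
  shows "pinnacles (m # xs) = pinnacles xs"
proof (cases xs)
  case (Cons a ys)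
  then have "\<not> m < a" using assms by (simp add: less_imp_not_less)
  with Cons show ?thesis by (cases ys) auto
qed auto

text \<open>A window of three consecutive letters lies in \<open>us\<close>, lies in
  \<open>vs\<close>, or contains \<open>m\<close>. In the last case only a window centred at
  \<open>m\<close> yields a pinnacle, and it exists exactly when both sides are nonempty.\<close>

lemma pinnacles_append_max:
  assumes "\<And>x. x \<in> set us \<union> set vs \<Longrightarrow> x < m"
  shows "pinnacles (us @ m # vs) =
    pinnacles us \<union> pinnacles vs \<union> (if us \<noteq> [] \<and> vs \<noteq> [] then {m} else {})"
  using assms
proof (induction us rule: pinnacles.induct)
  case (1 a b c xs)
  have "pinnacles ((b # c # xs) @ m # vs) =
    pinnacles (b # c # xs) \<union> pinnacles vs \<union> (if vs \<noteq> [] then {m} else {})"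
    using 1 by simp
  then show ?case by (simp add: Un_assoc del: if_split)
next
  case "2_1"
  then show ?case by (simp add: pinnacles_Cons_max)
next
  case ("2_2" a)
  then have "pinnacles (m # vs) = pinnacles vs" by (simp add: pinnacles_Cons_max)
  then show ?case using "2_2" by (cases vs) auto
next
  case ("2_3" a b)
  then have "pinnacles (m # vs) = pinnacles vs" "\<not> m < b"
    by (simp_all add: pinnacles_Cons_max less_imp_not_less)
  then show ?case using "2_3" by (cases vs) auto
qed

text \<open>The recursive form suits induction on words; this positional form is the one that can be
  compared with \<open>Pin\<close>. The index \<open>i\<close> marks the left end of a window and is
  counted from 0.\<close>

lemma pinnacles_conv_nth:
  "pinnacles xs = {xs ! Suc i | i. i + 2 < length xs \<and> xs ! i < xs ! Suc i \<and> xs ! (i + 2) < xs ! Suc i}"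
    (is "_ = ?P xs")
proof (induction xs rule: pinnacles.induct)
  case (1 a b c xs)
  have "?P (a # b # c # xs) = (if a < b \<and> c < b then {b} else {}) \<union> ?P (b # c # xs)"
    (is "?L = ?R")
  proof
    show "?L \<subseteq> ?R"
    proof
      fix x assume "x \<in> ?L"
      then obtain i where i: "x = (a # b # c # xs) ! Suc i" "i + 2 < length (a # b # c # xs)"
        "(a # b # c # xs) ! i < (a # b # c # xs) ! Suc i"
        "(a # b # c # xs) ! (i + 2) < (a # b # c # xs) ! Suc i" by blast
      show "x \<in> ?R"
      \<comment> \<open>Index 0 is the window \<open>a\<close>, \<open>b\<close>, \<open>c\<close>;
        index \<open>Suc j\<close> is the window at \<open>j\<close> in the tail.\<close>
      proof (cases i)
        case 0
        then show ?thesis using i by simp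
      next
        case (Suc j)
        then have "x \<in> ?P (b # c # xs)"
          using i by (intro CollectI exI[of _ j]) simp
        then show ?thesis by blast
      qed
    qed
    show "?R \<subseteq> ?L"
    proof
      fix x assume "x \<in> ?R"
      then consider "a < b" "c < b" "x = b" | "x \<in> ?P (b # c # xs)"
        by (auto split: if_splits)
      then show "x \<in> ?L"
      proof cases
        case 1
        then show ?thesis by (intro CollectI exI[of _ 0]) simp
      next
        case 2
        then obtain i where "x = (b # c # xs) ! Suc i" "i + 2 < length (b # c # xs)"
          "(b # c # xs) ! i < (b # c # xs) ! Suc i"
          "(b # c # xs) ! (i + 2) < (b # c # xs) ! Suc i" by blast
        then show ?thesis by (intro CollectI exI[of _ "Suc i"]) simp
      qed
    qed
  qed
  with 1 show ?case by simp
qed auto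

section \<open>Splitting a word at its maximal letter\<close>

definition words_with_pinnacles :: "'a::linorder set \<Rightarrow> 'a set \<Rightarrow> 'a list set" where
  "words_with_pinnacles X T = {xs \<in> permutations_of_set X. pinnacles xs = T}"

lemma finite_words_with_pinnacles [simp]: "finite (words_with_pinnacles X T)"
  by (simp add: words_with_pinnacles_def)

lemma words_with_pinnaclesD:
  assumes "xs \<in> words_with_pinnacles X T"
  shows "set xs = X" "distinct xs" "pinnacles xs = T"
  using assms by (auto simp: words_with_pinnacles_def permutations_of_set_def)

text \<open>Since \<open>m\<close> is in \<open>T\<close>, it must have letters on both sides, which
  is why \<open>A\<close> is nonempty and proper. The letters of \<open>us\<close> and
  \<open>vs\<close> are disjoint, so each pinnacle of the word other than \<open>m\<close> belongs
  to the factor that contains it as a letter.\<close>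

lemma bij_betw_split_at_max:
  assumes less: "\<And>x. x \<in> X \<Longrightarrow> x < m" and "m \<in> T" "T \<subseteq> insert m X"
  shows "bij_betw (\<lambda>(A, us, vs). us @ m # vs)
    (SIGMA A:{A. A \<noteq> {} \<and> A \<subset> X}.
      words_with_pinnacles A (T \<inter> A) \<times> words_with_pinnacles (X - A) (T \<inter> (X - A)))
    (words_with_pinnacles (insert m X) T)"
    (is "bij_betw ?f ?D ?W")
proof -
  have m: "m \<notin> X" using less by blast
  have "inj_on ?f ?D"
  proof (rule inj_onI)
    fix p q assume D: "p \<in> ?D" "q \<in> ?D" and eq: "?f p = ?f q"
    obtain A us vs B us' vs' where pq: "p = (A, us, vs)" "q = (B, us', vs')"
      by (metis prod_cases3)
    then have sets: "set us = A" "set us' = B" "set vs = X - A" "set vs' = X - B" "A \<subset> X" "B \<subset> X"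
      using D by (auto dest: words_with_pinnaclesD)
    then have "m \<notin> set us" "m \<notin> set us'" "m \<notin> set vs" "m \<notin> set vs'" using m by auto
    \<comment> \<open>The letter \<open>m\<close> occurs only once, so its position determines both
      factors.\<close>
    then have "us = us' \<and> vs = vs'" using eq by (simp add: pq append_Cons_eq_iff)
    then show "p = q" using sets pq by simp
  qed
  moreover have "?f p \<in> ?W" if D: "p \<in> ?D" for p
  proof -
    obtain A us vs where p: "p = (A, us, vs)" and A: "A \<noteq> {}" "A \<subset> X"
      and us: "us \<in> words_with_pinnacles A (T \<inter> A)"
      and vs: "vs \<in> words_with_pinnacles (X - A) (T \<inter> (X - A))" using D by auto
    note us = words_with_pinnaclesD[OF us] and vs = words_with_pinnaclesD[OF vs]
    have "pinnacles (us @ m # vs) =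
        pinnacles us \<union> pinnacles vs \<union> (if us \<noteq> [] \<and> vs \<noteq> [] then {m} else {})"
      using A us vs less by (intro pinnacles_append_max) blast
    also have "\<dots> = (T \<inter> A) \<union> (T \<inter> (X - A)) \<union> {m}" using us vs A by auto
    also have "\<dots> = T" using assms(2,3) A by blast
    finally show ?thesis
      using us vs A m by (auto simp: p words_with_pinnacles_def permutations_of_set_def)
  qed
  moreover have "xs \<in> ?f ` ?D" if W: "xs \<in> ?W" for xs
  proof -
    note xs = words_with_pinnaclesD[OF W]
    obtain us vs where split: "xs = us @ m # vs"
      using xs(1) by (metis insertI1 split_list)
    have X: "set us \<union> set vs = X" "set us \<inter> set vs = {}"
      using xs(1,2) m unfolding split by auto
    have T: "T = pinnacles us \<union> pinnacles vs \<union> (if us \<noteq> [] \<and> vs \<noteq> [] then {m} else {})"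
      using pinnacles_append_max[of us vs m] less X xs(3) unfolding split by auto
    have sub: "pinnacles us \<subseteq> set us" "pinnacles vs \<subseteq> set vs" by (rule pinnacles_subset)+
    have "m \<notin> set us" "m \<notin> set vs" using X(1) m by auto
    with sub have "m \<notin> pinnacles us" "m \<notin> pinnacles vs" by blast+
    \<comment> \<open>As \<open>m\<close> is a pinnacle of neither factor, its membership in
      \<open>T\<close> can only come from the conditional term.\<close>
    then have ne: "us \<noteq> [] \<and> vs \<noteq> []"
      using \<open>m \<in> T\<close> unfolding T by (simp split: if_split_asm)
    then have "set us \<noteq> {}" "set vs \<noteq> {}" by simp_all
    have vs: "set vs = X - set us" unfolding X(1)[symmetric] using X(2) by blast
    have us: "set us \<subset> X"
      unfolding psubset_eq using X(1) vs \<open>set vs \<noteq> {}\<close> by auto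
    have "T = pinnacles us \<union> pinnacles vs \<union> {m}" using T ne by simp
    \<comment> \<open>Disjointness of the letter sets lets intersection with each of them recover
      the pinnacles of that factor.\<close>
    then have "pinnacles us = T \<inter> set us" "pinnacles vs = T \<inter> set vs"
      using sub X(2) \<open>m \<notin> set us\<close> \<open>m \<notin> set vs\<close> by blast+
    moreover have "distinct us" "distinct vs" using xs(2) unfolding split by simp_all
    ultimately have "us \<in> words_with_pinnacles (set us) (T \<inter> set us)"
      "vs \<in> words_with_pinnacles (X - set us) (T \<inter> (X - set us))"
      unfolding vs[symmetric] words_with_pinnacles_def permutations_of_set_def by simp_all
    with us \<open>set us \<noteq> {}\<close> have "(set us, us, vs) \<in> ?D" by simp
    then show ?thesis unfolding split by (rule rev_image_eqI) simp
  qed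
  ultimately show ?thesis unfolding bij_betw_def by blast
qed

lemma card_words_with_pinnacles_insert_max:
  assumes "finite X" "\<And>x. x \<in> X \<Longrightarrow> x < m" "m \<in> T" "T \<subseteq> insert m X"
  shows "card (words_with_pinnacles (insert m X) T) =
    (\<Sum>A | A \<noteq> {} \<and> A \<subset> X.
      card (words_with_pinnacles A (T \<inter> A)) * card (words_with_pinnacles (X - A) (T \<inter> (X - A))))"
proof -
  have "finite {A. A \<noteq> {} \<and> A \<subset> X}"
    by (rule finite_subset[of _ "Pow X"]) (use assms(1) in auto)
  then show ?thesis
    using bij_betw_same_card[OF bij_betw_split_at_max[OF assms(2-4)]]
    by (simp add: card_SigmaI card_cartesian_product)
qed

section \<open>Relabelling permutations as words, and standardization\<close>

lemma Pin_subset: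
  assumes "w permutes {1..k}"
  shows "Pin k w \<subseteq> {1..k}"
proof
  fix x assume "x \<in> Pin k w"
  then obtain i where "x = w i" "i \<in> {1..k}" by (auto simp: Pin_def)
  then show "x \<in> {1..k}" using permutes_in_image[OF assms] by blast
qed

text \<open>A strictly increasing relabelling keeps every comparison between neighbouring
  letters.\<close>

lemma pinnacles_map_permutes:
  assumes w: "w permutes {1..r}" and e: "strict_mono_on {1..r} e"
  shows "pinnacles (map (\<lambda>i. e (w i)) [1..<Suc r]) = e ` Pin r w"
proof -
  have mem: "w i \<in> {1..r}" if "i \<in> {1..r}" for i using permutes_in_image[OF w] that by blast
  have less: "e (w i) < e (w j) \<longleftrightarrow> w i < w j" if "i \<in> {1..r}" "j \<in> {1..r}" for i j
    using strict_mono_on_less[OF e mem mem] that by blast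
  \<comment> \<open>List entry \<open>i\<close> is \<open>e (w (i + 1))\<close>, so the window
    starting at entry \<open>i\<close> is centred at position \<open>i + 2\<close> of
    \<open>w\<close>.\<close>
  have "pinnacles (map (\<lambda>i. e (w i)) [1..<Suc r]) =
     {e (w (i + 2)) | i. i + 2 < r \<and> e (w (i + 1)) < e (w (i + 2)) \<and> e (w (i + 3)) < e (w (i + 2))}"
    unfolding pinnacles_conv_nth
    by (rule Collect_cong, rule ex_cong1)
      (auto simp del: upt_Suc simp: eval_nat_numeral)
  also have "\<dots> = {e (w (i + 2)) | i. i + 2 < r \<and> w (i + 1) < w (i + 2) \<and> w (i + 3) < w (i + 2)}"
    by (rule Collect_cong, rule ex_cong1) (auto simp: less)
  also have "\<dots> = e ` Pin r w"
  proof (intro subset_antisym subsetI)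
    fix x assume "x \<in> {e (w (i + 2)) | i. i + 2 < r \<and> w (i + 1) < w (i + 2) \<and> w (i + 3) < w (i + 2)}"
    then obtain i where i: "x = e (w (i + 2))" "i + 2 < r" "w (i + 1) < w (i + 2)" "w (i + 3) < w (i + 2)"
      by blast
    then have "w (i + 2) \<in> Pin r w"
      unfolding Pin_def by (intro CollectI exI[of _ "i + 2"]) (auto simp: eval_nat_numeral)
    then show "x \<in> e ` Pin r w" using i by blast
  next
    fix x assume "x \<in> e ` Pin r w"
    then obtain j where j: "x = e (w j)" "2 \<le> j" "j \<le> r - 1" "w (j - 1) < w j" "w (j + 1) < w j"
      unfolding Pin_def by blast
    moreover from j obtain i where "j = i + 2" using le_Suc_ex[OF j(2)] by (auto simp: add.commute)
    ultimately show "x \<in> {e (w (i + 2)) | i. i + 2 < r \<and> w (i + 1) < w (i + 2) \<and> w (i + 3) < w (i + 2)}"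
      by (intro CollectI exI[of _ i]) (auto simp: eval_nat_numeral)
  qed
  finally show ?thesis .
qed

lemma bij_betw_permutes_permutations_of_set:
  fixes e :: "nat \<Rightarrow> 'a"
  assumes e: "bij_betw e {1..r} X"
  shows "bij_betw (\<lambda>w. map (\<lambda>i. e (w i)) [1..<Suc r]) {w. w permutes {1..r}} (permutations_of_set X)"
    (is "bij_betw ?F ?P _")
proof -
  have inj: "inj_on e {1..r}" and img: "e ` {1..r} = X" using e by (auto simp: bij_betw_def)
  have set: "set [1..<Suc r] = {1..r}" by auto
  have "inj_on ?F ?P"
  proof (rule inj_onI)
    fix v w assume "v \<in> ?P" "w \<in> ?P" and eq: "?F v = ?F w"
    then have v: "v permutes {1..r}" and w: "w permutes {1..r}" by simp_all
    show "v = w"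
    proof
      fix i
      show "v i = w i"
      proof (cases "i \<in> {1..r}")
        case True
        then have "e (v i) = e (w i)" using eq by (simp only: map_eq_conv set)
        moreover have "v i \<in> {1..r}" "w i \<in> {1..r}"
          using True by (simp_all only: permutes_in_image[OF v] permutes_in_image[OF w])
        ultimately show ?thesis by (rule inj_onD[OF inj])
      next
        case False
        then show ?thesis by (metis permutes_not_in v w)
      qed
    qed
  qed
  moreover have "?F w \<in> permutations_of_set X" if "w \<in> ?P" for w
  proof -
    have w: "w permutes {1..r}" using that by simp
    have bij: "bij_betw (\<lambda>i. e (w i)) {1..r} X"
      using bij_betw_trans[OF permutes_imp_bij[OF w] e] by (simp add: comp_def)
    then show ?thesis
      using set by (auto simp: permutations_of_set_def distinct_map bij_betw_def simp del: upt_Suc)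
  qed
  moreover have "xs \<in> ?F ` ?P" if xs: "xs \<in> permutations_of_set X" for xs
  proof -
    have xs': "set xs = X" "distinct xs" using xs by (auto simp: permutations_of_set_def)
    have len: "length xs = r"
      using xs' bij_betw_same_card[OF e] distinct_card[of xs] by simp
    have shift: "bij_betw (\<lambda>i. i - 1) {1..r} {..<r}"
      by (rule bij_betw_byWitness[where f' = Suc]) auto
    have "bij_betw ((!) xs) {..<r} X" using xs' len by (simp add: bij_betw_nth)
    from bij_betw_trans[OF bij_betw_trans[OF shift this] bij_betw_the_inv_into[OF e]]
    have g: "bij_betw (\<lambda>i. the_inv_into {1..r} e (xs ! (i - 1))) {1..r} {1..r}"
      by (simp add: comp_def)
    \<comment> \<open>Each letter of \<open>xs\<close> is read back through \<open>e\<close>; the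
      value \<open>i\<close> outside \<open>{1..r}\<close> is what \<open>permutes\<close>
      demands.\<close>
    define w where "w i = (if i \<in> {1..r} then the_inv_into {1..r} e (xs ! (i - 1)) else i)" for i
    have "bij_betw w {1..r} {1..r}"
      using g by (subst bij_betw_cong[where g = "\<lambda>i. the_inv_into {1..r} e (xs ! (i - 1))"]) (auto simp: w_def)
    then have w: "w permutes {1..r}" by (rule bij_imp_permutes) (auto simp: w_def)
    have "?F w = xs"
    proof (rule nth_equalityI)
      fix i assume "i < length (?F w)"
      then have i: "i < r" by (simp del: upt_Suc)
      then have "xs ! i \<in> X" using xs' len by auto
      then have "e (w (Suc i)) = xs ! i"
        using f_the_inv_into_f[OF inj, of "xs ! i"] i img by (simp add: w_def)
      then show "?F w ! i = xs ! i" using i by (simp del: upt_Suc)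
    qed (simp add: len del: upt_Suc)
    then show ?thesis using w by blast
  qed
  ultimately show ?thesis unfolding bij_betw_def by blast
qed

lemma strict_mono_on_sorted_list_of_set_nth:
  fixes X :: "'a::linorder set"
  shows "strict_mono_on {1..card X} (\<lambda>i. sorted_list_of_set X ! (i - 1))"
proof (rule strict_mono_onI)
  fix i j assume "i \<in> {1..card X}" "j \<in> {1..card X}" "i < j"
  then have "i - 1 < j - 1" "j - 1 < length (sorted_list_of_set X)" by auto
  then show "sorted_list_of_set X ! (i - 1) < sorted_list_of_set X ! (j - 1)"
    using strict_sorted_list_of_set by (rule sorted_wrt_nth_less[rotated])
qed

lemma sorted_list_of_set_nth_image:
  fixes X :: "'a::linorder set"
  assumes "finite X"
  shows "(\<lambda>i. sorted_list_of_set X ! (i - 1)) ` {1..card X} = X"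
proof -
  have "bij_betw (\<lambda>i. i - 1) {1..card X} {..<card X}"
    by (rule bij_betw_byWitness[where f' = Suc]) auto
  then have "(\<lambda>i. sorted_list_of_set X ! (i - 1)) ` {1..card X} = (!) (sorted_list_of_set X) ` {..<card X}"
    by (subst bij_betw_imp_surj_on[symmetric]) (assumption, simp only: image_image)
  also have "\<dots> = set (sorted_list_of_set X)"
    by (auto simp: set_conv_nth)
  finally show ?thesis using assms by simp
qed

text \<open>The increasing enumeration of \<open>X\<close> maps \<open>std X S\<close> onto
  \<open>S \<inter> X\<close> and carries pinnacles to pinnacles. Standardized counts thus become
  counts of words whose letters are the elements of \<open>X\<close> themselves.\<close>

lemma pinnacle_count_std:
  fixes X :: "'a::linorder set"
  assumes "finite X"
  shows "pinnacle_count (std X S) (card X) = card (words_with_pinnacles X (S \<inter> X))"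
proof -
  define r where "r = card X"
  define e where "e i = sorted_list_of_set X ! (i - 1)" for i
  let ?F = "\<lambda>w. map (\<lambda>i. e (w i)) [1..<Suc r]"
  have mono: "strict_mono_on {1..r} e"
    using strict_mono_on_sorted_list_of_set_nth unfolding r_def e_def .
  have img: "e ` {1..r} = X"
    using sorted_list_of_set_nth_image[OF assms] unfolding r_def e_def .
  have inj: "inj_on e {1..r}" using mono by (rule strict_mono_on_imp_inj_on)
  have bij: "bij_betw ?F {w. w permutes {1..r}} (permutations_of_set X)"
    using inj img by (intro bij_betw_permutes_permutations_of_set) (simp add: bij_betw_def)
  have "std X S = {i \<in> {1..r}. e i \<in> S}" by (simp add: std_def r_def e_def)
  then have std: "std X S \<subseteq> {1..r}" "e ` std X S = S \<inter> X" using img by blast+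
  \<comment> \<open>Both sets lie in \<open>{1..r}\<close>, where \<open>e\<close> is injective, so
    they agree exactly when their images do.\<close>
  have iff: "Pin r w = std X S \<longleftrightarrow> pinnacles (?F w) = S \<inter> X" if "w permutes {1..r}" for w
    using inj_on_image_eq_iff[OF inj Pin_subset[OF that] std(1)] pinnacles_map_permutes[OF that mono] std(2)
    by simp
  have "bij_betw ?F {w \<in> {w. w permutes {1..r}}. Pin r w = std X S} (words_with_pinnacles X (S \<inter> X))"
    unfolding words_with_pinnacles_def
    using bij iff by (intro bij_betw_Collect) auto
  then show ?thesis
    unfolding pinnacle_count_def r_def[symmetric] by (simp add: bij_betw_same_card)
qed

text \<open>The increasing enumeration of \<open>{1..n}\<close> is the identity, so the count on the
  left of the recurrence is also a standardized one.\<close>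

lemma std_atLeastAtMost:
  assumes "S \<subseteq> {1..n}"
  shows "std {1..n} S = S"
proof -
  have "sorted_list_of_set {1..n} = [1..<Suc n]"
    by (simp only: atLeastLessThanSuc_atLeastAtMost[symmetric] sorted_list_of_set_range)
  then show ?thesis
    using assms by (auto simp: std_def simp del: upt_Suc)
qed

theorem proposition3p3:
  fixes S :: "nat set" and n :: nat
  assumes "S \<noteq> {}"
    and "admissible_pinnacle_set S"
    and "Max S = n"
  shows "pinnacle_count S n =
    (\<Sum>A | A \<noteq> {} \<and> A \<subset> {1..n - 1}.
       pinnacle_count (std A S) (card A) *
       pinnacle_count (std ({1..n - 1} - A) S) (n - 1 - card A))"
proof -
  \<comment> \<open>Admissibility makes \<open>S\<close> finite, so that its maximum is attained,
    and keeps 0 out of \<open>S\<close>.\<close>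
  obtain k where k: "S \<subseteq> {1..k}"
    using assms(2) Pin_subset by (auto simp: admissible_pinnacle_set_def)
  then have fin: "finite S" by (rule finite_subset) simp
  have n: "n \<in> S" using Max_in[OF fin assms(1)] assms(3) by simp
  have S: "S \<subseteq> {1..n}"
    using k Max_ge[OF fin] assms(3) by auto
  \<comment> \<open>From \<open>n\<close> in \<open>S\<close> it follows that \<open>n\<close> is at
    least 1, so the truncated subtraction \<open>n - 1\<close> is a true one.\<close>
  have ins: "{1..n} = insert n {1..n - 1}" using n S by auto
  have "pinnacle_count S n = card (words_with_pinnacles {1..n} S)"
    using pinnacle_count_std[of "{1..n}" S] std_atLeastAtMost[OF S] S by (simp add: Int_absorb2)
  also have "\<dots> = (\<Sum>A | A \<noteq> {} \<and> A \<subset> {1..n - 1}. card (words_with_pinnacles A (S \<inter> A)) *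
      card (words_with_pinnacles ({1..n - 1} - A) (S \<inter> ({1..n - 1} - A))))"
    unfolding ins using n S by (intro card_words_with_pinnacles_insert_max) auto
  also have "\<dots> = (\<Sum>A | A \<noteq> {} \<and> A \<subset> {1..n - 1}.
       pinnacle_count (std A S) (card A) *
       pinnacle_count (std ({1..n - 1} - A) S) (n - 1 - card A))"
  proof (rule sum.cong)
    fix A assume "A \<in> {A. A \<noteq> {} \<and> A \<subset> {1..n - 1}}"
    then have A: "A \<subseteq> {1..n - 1}" "finite A" by (auto intro: finite_subset)
    then have "card ({1..n - 1} - A) = n - 1 - card A" by (simp add: card_Diff_subset)
    then show "card (words_with_pinnacles A (S \<inter> A)) *
        card (words_with_pinnacles ({1..n - 1} - A) (S \<inter> ({1..n - 1} - A))) =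
      pinnacle_count (std A S) (card A) *
        pinnacle_count (std ({1..n - 1} - A) S) (n - 1 - card A)"
      using pinnacle_count_std[OF A(2), of S] pinnacle_count_std[of "{1..n - 1} - A" S] by simp
  qed simp
  finally show ?thesis .
qed

end
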